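(* Let $(A,M,\{P_x\}_{x\in X})$ be a matching relative Rota-Baxter algebra. The set of all equivalence classes of infinitesimal deformations of $(A,M,\{P_x\}_{x\in X})$ is classified by the second cohomology group $H^2_{\mathrm{mrRBA}}(A,M,\{P_x\}_{x\in X})$; that is, assigning to an infinitesimal deformation $(\mu+t\mu_1,\,l+tl_1,\,r+tr_1,\,\{P_x+tP_{1,x}\}_{x\in X})$ the cohomology class of $(\mu_1,\beta_1,P_1)$ induces a bijection from the set of equivalence classes of infinitesimal deformations onto $H^2_{\mathrm{mrRBA}}(A,M,\{P_x\}_{x\in X})$.
   Context: $\mathbb K$ is a commutative unital ring with $\mathrm{char}\,\mathbb K\neq 2$; all modules, linear maps, Hom spaces and tensor products are over $\mathbb K$ unless specified; $X$ is a nonempty set. $\mu(a,b)=a\cdot b$ denotes the product of $A$, and $l(a,u)=l_M(a,u)=a\cdot_M u$, $r(u,a)=r_M(u,a)=u\cdot_M a$ the left and right actions on the $A$-bimodule $M$. A matching relative Rota-Baxter algebra is a triple $(A,M,\{P_x\}_{x\in X})$ of an associative algebra $A$, an $A$-bimodule $M$ and linear maps $P_x:M\to A$ such that $P_x(u)\cdot P_y(v)=P_x(u\cdot_M P_y(v))+P_y(P_x(u)\cdot_M v)$ for all $u,v\in M$, $x,y\in X$. A morphism $(A,M,\{P_x\})\to(A',M',\{P'_x\})$ is a pair $(\varphi,\psi)$ of an algebra homomorphism $\varphi:A\to A'$ and a linear map $\psi:M\to M'$ with $\psi(a\cdot_Mu)=\varphi(a)\cdot_{M'}\psi(u)$, $\psi(u\cdot_Ma)=\psi(u)\cdot_{M'}\varphi(a)$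 and $\varphi\circ P_x=P'_x\circ\psi$ for all $a,u,x$. An infinitesimal deformation of $(A,M,\{P_x\})$ is a tuple $\mu_t=\mu+t\mu_1$, $l_t=l+tl_1$, $r_t=r+tr_1$, $(P_t)_x=P_x+tP_{1,x}$ $(x\in X)$ with $\mu_1\in\mathrm{Hom}(A^{\otimes2},A)$, $l_1\in\mathrm{Hom}(A\otimes M,M)$, $r_1\in\mathrm{Hom}(M\otimes A,M)$, $P_{1,x}\in\mathrm{Hom}(M,A)$, such that $((A[[t]]/(t^2),\mu_t),(M[[t]]/(t^2),l_t,r_t),\{(P_t)_x\}_{x\in X})$ is a matching relative Rota-Baxter algebra over $\mathbb K[[t]]/(t^2)$. Two infinitesimal deformations are equivalent if there are $\varphi_t=\mathrm{id}_A+t\varphi_1$, $\psi_t=\mathrm{id}_M+t\psi_1$ ($\varphi_1\in\mathrm{Hom}(A,A)$, $\psi_1\in\mathrm{Hom}(M,M)$) such that $(\varphi_t,\psi_t)$ is a morphism of matching relative Rota-Baxter algebras over $\mathbb K[[t]]/(t^2)$ from the first deformed structure to the second. Here $\beta_1\in\mathrm{Hom}(\mathcal A^{1,1},M)$ is $\beta_1(a,u)=l_1(a,u)$, $\beta_1(u,a)=r_1(u,a)$, and $P_1=\oplus_{x\in X}P_{1,x}$. The complex: $\mathcal A^{n-1,1}$ is the direct sum of all $n$-fold tensor products of $A$ and $M$ in which $A$ appears $n-1$ times and $M$ exactly once. $C^n_{\{P_x\}}(M,A)$ is, for $n\ge1$, the $\mathbb K$-module of all families $f=\oplus f_{x_1,\dots,x_n}$,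 $f_{x_1,\dots,x_n}\in\mathrm{Hom}(M^{\otimes n},A)$, indexed by $X^{\times n}$, with $$(\delta_{\{P_x\}}f)_{x_1,\dots,x_{n+1}}(u_1,\dots,u_{n+1})=P_{x_1}(u_1)\cdot f_{x_2,\dots,x_{n+1}}(u_2,\dots,u_{n+1})-P_{x_1}(u_1\cdot_M f_{x_2,\dots,x_{n+1}}(u_2,\dots,u_{n+1}))$$ $$+\sum_{i=1}^n(-1)^i f_{x_1,\dots,x_i,x_{i+2},\dots,x_{n+1}}(u_1,\dots,u_{i-1},u_i\cdot_M P_{x_{i+1}}(u_{i+1}),\dots,u_{n+1})$$ $$+\sum_{i=1}^n(-1)^i f_{x_1,\dots,x_{i-1},x_{i+1},\dots,x_{n+1}}(u_1,\dots,u_{i-1},P_{x_i}(u_i)\cdot_M u_{i+1},\dots,u_{n+1})$$ $$+(-1)^{n+1}f_{x_1,\dots,x_n}(u_1,\dots,u_n)\cdot P_{x_{n+1}}(u_{n+1})-(-1)^{n+1}P_{x_{n+1}}(f_{x_1,\dots,x_n}(u_1,\dots,u_n)\cdot_M u_{n+1}).$$ $C^0_{\mathrm{mrRBA}}=0$, $C^1_{\mathrm{mrRBA}}=\mathrm{Hom}(A,A)\oplus\mathrm{Hom}(M,M)$, and for $n\ge2$, $C^n_{\mathrm{mrRBA}}=\mathrm{Hom}(A^{\otimes n},A)\oplus\mathrm{Hom}(\mathcal A^{n-1,1},M)\oplus C^{n-1}_{\{P_x\}}(M,A)$. $\delta_{\mathrm{Hoch}}$ is the Hochschild coboundary of $A$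 with coefficients in $A$: $\delta_{\mathrm{Hoch}}(f)(a_1,\dots,a_{n+1})=a_1\cdot f(a_2,\dots,a_{n+1})+\sum_{i=1}^n(-1)^if(a_1,\dots,a_i\cdot a_{i+1},\dots,a_{n+1})+(-1)^{n+1}f(a_1,\dots,a_n)\cdot a_{n+1}$. For $\alpha\in\mathrm{Hom}(A^{\otimes n},A)$, $\beta\in\mathrm{Hom}(\mathcal A^{n-1,1},M)$, $$\delta^\alpha_{\mathrm{Hoch}}(\beta)(a_1,\dots,a_{n+1})=(l_M+r_M)(a_1,(\alpha+\beta)(a_2,\dots,a_{n+1}))+\sum_{i=1}^n(-1)^i\beta(a_1,\dots,(\mu+l_M+r_M)(a_i,a_{i+1}),\dots,a_{n+1})+(-1)^{n+1}(l_M+r_M)((\alpha+\beta)(a_1,\dots,a_n),a_{n+1}),$$ where exactly one $a_j$ lies in $M$ and the others in $A$, and in each sum of maps one applies the unique summand whose domain matches the arguments. Also $$(h_{\{P_x\}}(\alpha,\beta))_{x_1,\dots,x_n}(u_1,\dots,u_n)=(-1)^n\Big\{\alpha(P_{x_1}(u_1),\dots,P_{x_n}(u_n))-\sum_{i=1}^nP_{x_i}\beta(P_{x_1}(u_1),\dots,u_i,\dots,P_{x_n}(u_n))\Big\}.$$ $\delta_{\mathrm{mrRBA}}(\alpha,\beta)=(\delta_{\mathrm{Hoch}}(\alpha),\delta^\alpha_{\mathrm{Hoch}}(\beta),h_{\{P_x\}}(\alpha,\beta))$ on $C^1_{\mathrm{mrRBA}}$, and $\delta_{\mathrm{mrRBA}}(\alpha,\beta,\gamma)=(\delta_{\mathrm{Hoch}}(\alpha),\delta^\alpha_{\mathrm{Hoch}}(\beta),\delta_{\{P_x\}}(\gamma)+h_{\{P_x\}}(\alpha,\beta))$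 on $C^n_{\mathrm{mrRBA}}$, $n\ge2$. $H^n_{\mathrm{mrRBA}}$ denotes the cohomology of this cochain complex. *)

theory Defs
  imports
    "HOL-Computational_Algebra.Formal_Power_Series"
    "HOL-Library.Function_Algebras"
    "HOL-Library.Product_Plus"
    "HOL-Algebra.Coset"
begin

section \<open>Matching relative Rota-Baxter algebras\<close>

definition bilinear_map ::
  "('k::comm_ring_1 \<Rightarrow> 'a::ab_group_add \<Rightarrow> 'a) \<Rightarrow> ('k \<Rightarrow> 'b::ab_group_add \<Rightarrow> 'b) \<Rightarrow>
   ('k \<Rightarrow> 'c::ab_group_add \<Rightarrow> 'c) \<Rightarrow> ('a \<Rightarrow> 'b \<Rightarrow> 'c) \<Rightarrow> bool" where
  "bilinear_map s1 s2 s3 f \<longleftrightarrow>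
     (\<forall>x. module_hom s2 s3 (\<lambda>y. f x y)) \<and> (\<forall>y. module_hom s1 s3 (\<lambda>x. f x y))"

text \<open>
  A and M are the types 'a and 'm with scalar actions sA and sM of the ground ring 'k.
  The index set X is the type 'x, which is automatically nonempty.  A is not assumed unital.
\<close>

locale mrrb_data =
  fixes sA :: "'k::comm_ring_1 \<Rightarrow> 'a::ab_group_add \<Rightarrow> 'a"
    and sM :: "'k \<Rightarrow> 'm::ab_group_add \<Rightarrow> 'm"
    and mu :: "'a \<Rightarrow> 'a \<Rightarrow> 'a"
    and l :: "'a \<Rightarrow> 'm \<Rightarrow> 'm"
    and r :: "'m \<Rightarrow> 'a \<Rightarrow> 'm"
    and P :: "'x \<Rightarrow> 'm \<Rightarrow> 'a"

locale mrrb_algebra = mrrb_data sA sM mu l r P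
  for sA :: "'k::comm_ring_1 \<Rightarrow> 'a::ab_group_add \<Rightarrow> 'a"
    and sM :: "'k \<Rightarrow> 'm::ab_group_add \<Rightarrow> 'm"
    and mu l r and P :: "'x \<Rightarrow> 'm \<Rightarrow> 'a" +
  assumes module_A: "module sA"
    and module_M: "module sM"
    and mu_bilinear: "bilinear_map sA sA sA mu"
    and mu_assoc: "mu (mu a b) c = mu a (mu b c)"
    and l_bilinear: "bilinear_map sA sM sM l"
    and r_bilinear: "bilinear_map sM sA sM r"
    and l_assoc: "l (mu a b) u = l a (l b u)"
    and lr_assoc: "r (l a u) b = l a (r u b)"
    and r_assoc: "r (r u a) b = r u (mu a b)"
    and P_linear: "module_hom sM sA (P x)"
    and P_matching: "mu (P x u) (P y v) = P x (r u (P y v)) + P y (l (P x u) v)"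

locale mrrb_morphism =
  src: mrrb_algebra sA sM mu l r P + tgt: mrrb_algebra sA' sM' mu' l' r' P'
  for sA :: "'k::comm_ring_1 \<Rightarrow> 'a::ab_group_add \<Rightarrow> 'a"
    and sM :: "'k \<Rightarrow> 'm::ab_group_add \<Rightarrow> 'm"
    and mu l r and P :: "'x \<Rightarrow> 'm \<Rightarrow> 'a"
    and sA' :: "'k \<Rightarrow> 'b::ab_group_add \<Rightarrow> 'b"
    and sM' :: "'k \<Rightarrow> 'n::ab_group_add \<Rightarrow> 'n"
    and mu' l' r' and P' :: "'x \<Rightarrow> 'n \<Rightarrow> 'b" +
  fixes \<phi> :: "'a \<Rightarrow> 'b" and \<psi> :: "'m \<Rightarrow> 'n"
  assumes phi_linear: "module_hom sA sA' \<phi>"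
    and phi_mult: "\<phi> (mu a b) = mu' (\<phi> a) (\<phi> b)"
    and psi_linear: "module_hom sM sM' \<psi>"
    and psi_left: "\<psi> (l a u) = l' (\<phi> a) (\<psi> u)"
    and psi_right: "\<psi> (r u a) = r' (\<psi> u) (\<phi> a)"
    and phi_P: "\<phi> (P x u) = P' x (\<psi> u)"


section \<open>Extension of scalars to power series modulo t squared\<close>

text \<open>
  \<open>TPS a b\<close> is the class of a + t b in A[[t]]/(t^2); for A = K this is the ring
  K[[t]]/(t^2) (see \<open>tps_of_fps\<close> below).
\<close>

datatype 'a tps = TPS (tcoeff0: 'a) (tcoeff1: 'a)

instantiation tps :: (ab_group_add) ab_group_add
begin
definition "0 = TPS 0 0"
definition "x + y = TPS (tcoeff0 x + tcoeff0 y) (tcoeff1 x + tcoeff1 y)"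
definition "x - y = TPS (tcoeff0 x - tcoeff0 y) (tcoeff1 x - tcoeff1 y)"
definition "- x = TPS (- tcoeff0 x) (- tcoeff1 x)"
instance
  by standard
    (simp_all add: zero_tps_def plus_tps_def minus_tps_def uminus_tps_def add.assoc add.commute tps.expand)
end

instantiation tps :: (comm_ring_1) comm_ring_1
begin
definition "1 = TPS 1 0"
definition "x * y =
  TPS (tcoeff0 x * tcoeff0 y) (tcoeff0 x * tcoeff1 y + tcoeff1 x * tcoeff0 y)"
instance
  by standard
    (simp_all add: zero_tps_def one_tps_def plus_tps_def times_tps_def algebra_simps tps.expand)
end

definition tps_of_fps :: "'a::zero fps \<Rightarrow> 'a tps" where
  "tps_of_fps f = TPS (fps_nth f 0) (fps_nth f 1)"

lemma tps_of_fps_ring_hom: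
  fixes f g :: "'a::comm_ring_1 fps"
  shows "tps_of_fps (f + g) = tps_of_fps f + tps_of_fps g"
    and "tps_of_fps (f * g) = tps_of_fps f * tps_of_fps g"
    and "tps_of_fps (1 :: 'a fps) = 1"
  by (simp_all add: tps_of_fps_def plus_tps_def times_tps_def one_tps_def fps_mult_nth_1)

lemma surj_tps_of_fps: "surj (tps_of_fps :: 'a::comm_ring_1 fps \<Rightarrow> 'a tps)"
proof (rule surjI)
  show "tps_of_fps (Abs_fps (\<lambda>n. if n = 0 then tcoeff0 x else tcoeff1 x)) = x" for x :: "'a tps"
    by (simp add: tps_of_fps_def)
qed

lemma tps_of_fps_eq_0_iff:
  fixes f :: "'a::comm_ring_1 fps"
  shows "tps_of_fps f = 0 \<longleftrightarrow> fps_X ^ 2 dvd f"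
proof
  assume "tps_of_fps f = 0"
  then have "fps_nth f 0 = 0" "fps_nth f (Suc 0) = 0"
    by (simp_all add: tps_of_fps_def zero_tps_def)
  then have "fps_nth f n = fps_nth (fps_X ^ 2 * fps_shift 2 f) n" for n
    by (cases "n < 2")
      (auto simp: fps_X_power_mult_nth less_2_cases_iff not_less fps_shift_nth
        simp del: add_2_eq_Suc' dest!: le_Suc_ex)
  then have "f = fps_X ^ 2 * fps_shift 2 f"
    by (simp add: fps_eq_iff)
  then show "fps_X ^ 2 dvd f"
    by (metis dvd_triv_left)
qed (auto simp: tps_of_fps_def zero_tps_def fps_X_power_mult_nth)

text \<open>
  The K[[t]]/(t^2)-module structure of A[[t]]/(t^2), and the K[[t]]/(t^2)-(bi)linear extensions
  of maps of the form f + t f1.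
\<close>

definition tps_scale :: "('k \<Rightarrow> 'a::ab_group_add \<Rightarrow> 'a) \<Rightarrow> 'k tps \<Rightarrow> 'a tps \<Rightarrow> 'a tps" where
  "tps_scale s c x =
     TPS (s (tcoeff0 c) (tcoeff0 x)) (s (tcoeff0 c) (tcoeff1 x) + s (tcoeff1 c) (tcoeff0 x))"

definition tps_linear_ext :: "('a \<Rightarrow> 'b::ab_group_add) \<Rightarrow> ('a \<Rightarrow> 'b) \<Rightarrow> 'a tps \<Rightarrow> 'b tps" where
  "tps_linear_ext f f1 x = TPS (f (tcoeff0 x)) (f (tcoeff1 x) + f1 (tcoeff0 x))"

definition tps_bilinear_ext ::
  "('a \<Rightarrow> 'b \<Rightarrow> 'c::ab_group_add) \<Rightarrow> ('a \<Rightarrow> 'b \<Rightarrow> 'c) \<Rightarrow> 'a tps \<Rightarrow> 'b tps \<Rightarrow> 'c tps" where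
  "tps_bilinear_ext f f1 x y =
     TPS (f (tcoeff0 x) (tcoeff0 y))
         (f (tcoeff0 x) (tcoeff1 y) + f (tcoeff1 x) (tcoeff0 y) + f1 (tcoeff0 x) (tcoeff0 y))"


section \<open>Infinitesimal deformations\<close>

text \<open>
  An infinitesimal deformation is recorded by its first-order terms \<open>(mu1, l1, r1, P1)\<close>.
\<close>

type_synonym ('a, 'm, 'x) first_order =
  "('a \<Rightarrow> 'a \<Rightarrow> 'a) \<times> ('a \<Rightarrow> 'm \<Rightarrow> 'm) \<times> ('m \<Rightarrow> 'a \<Rightarrow> 'm) \<times> ('x \<Rightarrow> 'm \<Rightarrow> 'a)"

context mrrb_data
begin

definition infinitesimal_deformations :: "('a, 'm, 'x) first_order set" where
  "infinitesimal_deformations = {(mu1, l1, r1, P1).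
     bilinear_map sA sA sA mu1 \<and> bilinear_map sA sM sM l1 \<and> bilinear_map sM sA sM r1 \<and>
     (\<forall>x. module_hom sM sA (P1 x)) \<and>
     mrrb_algebra (tps_scale sA) (tps_scale sM)
       (tps_bilinear_ext mu mu1) (tps_bilinear_ext l l1) (tps_bilinear_ext r r1)
       (\<lambda>x. tps_linear_ext (P x) (P1 x))}"

fun equivalent_deformations ::
  "('a, 'm, 'x) first_order \<Rightarrow> ('a, 'm, 'x) first_order \<Rightarrow> bool" where
  "equivalent_deformations (mu1, l1, r1, P1) (mu2, l2, r2, P2) \<longleftrightarrow>
     (\<exists>\<phi>1 \<psi>1. module_hom sA sA \<phi>1 \<and> module_hom sM sM \<psi>1 \<and>
        mrrb_morphism (tps_scale sA) (tps_scale sM)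
          (tps_bilinear_ext mu mu1) (tps_bilinear_ext l l1) (tps_bilinear_ext r r1)
          (\<lambda>x. tps_linear_ext (P x) (P1 x))
          (tps_scale sA) (tps_scale sM)
          (tps_bilinear_ext mu mu2) (tps_bilinear_ext l l2) (tps_bilinear_ext r r2)
          (\<lambda>x. tps_linear_ext (P x) (P2 x))
          (tps_linear_ext id \<phi>1) (tps_linear_ext id \<psi>1))"

definition deformation_equivalence ::
  "(('a, 'm, 'x) first_order \<times> ('a, 'm, 'x) first_order) set" where
  "deformation_equivalence =
     {(d, d'). d \<in> infinitesimal_deformations \<and> d' \<in> infinitesimal_deformations \<and>
        equivalent_deformations d d'}"

end


section \<open>The cochain complex\<close>

text \<open>
  Linear maps on tensor powers are multilinear functions on lists.  To make equality of cochains
  equality of functions, cochains vanish off the lists on which they are meaningful.  An element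
  of \<open>Hom(\<A>^{n-1,1}, M)\<close> is a function on words of length n over the disjoint sum of A and M
  with exactly one letter in M, multilinear for each position of that letter.
\<close>

type_synonym ('a, 'm, 'x) cochain =
  "('a list \<Rightarrow> 'a) \<times> (('a + 'm) list \<Rightarrow> 'm) \<times> ('x list \<Rightarrow> 'm list \<Rightarrow> 'a)"

definition multilinear_maps ::
  "('k::comm_ring_1 \<Rightarrow> 'a::ab_group_add \<Rightarrow> 'a) \<Rightarrow> ('k \<Rightarrow> 'b::ab_group_add \<Rightarrow> 'b) \<Rightarrow> nat \<Rightarrow>
   ('a list \<Rightarrow> 'b) set" where
  "multilinear_maps s1 s2 n = {f.
     (\<forall>as. length as \<noteq> n \<longrightarrow> f as = 0) \<and>
     (\<forall>as bs. length as + length bs + 1 = n \<longrightarrow> module_hom s1 s2 (\<lambda>a. f (as @ a # bs)))}"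

definition mixed_word :: "nat \<Rightarrow> ('a + 'm) list \<Rightarrow> bool" where
  "mixed_word n w \<longleftrightarrow> length w = n \<and> length (filter (\<lambda>z. \<not> isl z) w) = 1"

fun mixed_sum :: "('a list \<Rightarrow> 'a) \<Rightarrow> (('a + 'm) list \<Rightarrow> 'm) \<Rightarrow> ('a + 'm) list \<Rightarrow> 'a + 'm" where
  \<comment> \<open>the map denoted \<open>\<alpha> + \<beta>\<close>\<close>
  "mixed_sum \<alpha> \<beta> w = (if list_all isl w then Inl (\<alpha> (map projl w)) else Inr (\<beta> w))"

context mrrb_data
begin

definition mixed_maps :: "nat \<Rightarrow> (('a + 'm) list \<Rightarrow> 'm) set" where
  "mixed_maps n = {f.
     (\<forall>w. \<not> mixed_word n w \<longrightarrow> f w = 0) \<and>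
     (\<forall>v w. mixed_word n (v @ Inl 0 # w) \<longrightarrow> module_hom sA sM (\<lambda>a. f (v @ Inl a # w))) \<and>
     (\<forall>v w. mixed_word n (v @ Inr 0 # w) \<longrightarrow> module_hom sM sM (\<lambda>u. f (v @ Inr u # w)))}"

definition P_cochains :: "nat \<Rightarrow> ('x list \<Rightarrow> 'm list \<Rightarrow> 'a) set" where
  "P_cochains n = {f. (\<forall>xs. if length xs = n then f xs \<in> multilinear_maps sM sA n else f xs = 0)}"

text \<open>The maps \<open>l + r\<close> and \<open>mu + l + r\<close>; their values on two letters in M never matter.\<close>

fun action :: "'a + 'm \<Rightarrow> 'a + 'm \<Rightarrow> 'm" where
  "action (Inl a) (Inr u) = l a u"
| "action (Inr u) (Inl a) = r u a"
| "action _ _ = 0"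

fun mixed_mult :: "'a + 'm \<Rightarrow> 'a + 'm \<Rightarrow> 'a + 'm" where
  "mixed_mult (Inl a) (Inl b) = Inl (mu a b)"
| "mixed_mult z z' = Inr (action z z')"

text \<open>
  Summation indices i start at 1, so the i-th argument is \<open>as ! (i - 1)\<close>.
\<close>

definition hochschild :: "nat \<Rightarrow> ('a list \<Rightarrow> 'a) \<Rightarrow> 'a list \<Rightarrow> 'a" where
  "hochschild n f as = (if length as = n + 1 then
       mu (as ! 0) (f (drop 1 as))
     + (\<Sum>i = 1..n. sA ((- 1) ^ i) (f (take (i - 1) as @ mu (as ! (i - 1)) (as ! i) # drop (i + 1) as)))
     + sA ((- 1) ^ (n + 1)) (mu (f (take n as)) (as ! n))
     else 0)"

definition hochschild_mixed ::
  "nat \<Rightarrow> ('a list \<Rightarrow> 'a) \<Rightarrow> (('a + 'm) list \<Rightarrow> 'm) \<Rightarrow> ('a + 'm) list \<Rightarrow> 'm" where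
  "hochschild_mixed n \<alpha> \<beta> w = (if mixed_word (n + 1) w then
       action (w ! 0) (mixed_sum \<alpha> \<beta> (drop 1 w))
     + (\<Sum>i = 1..n. sM ((- 1) ^ i) (\<beta> (take (i - 1) w @ mixed_mult (w ! (i - 1)) (w ! i) # drop (i + 1) w)))
     + sM ((- 1) ^ (n + 1)) (action (mixed_sum \<alpha> \<beta> (take n w)) (w ! n))
     else 0)"

definition P_coboundary ::
  "nat \<Rightarrow> ('x list \<Rightarrow> 'm list \<Rightarrow> 'a) \<Rightarrow> 'x list \<Rightarrow> 'm list \<Rightarrow> 'a" where
  "P_coboundary n f xs us = (if length xs = n + 1 \<and> length us = n + 1 then
       mu (P (xs ! 0) (us ! 0)) (f (drop 1 xs) (drop 1 us))
     - P (xs ! 0) (r (us ! 0) (f (drop 1 xs) (drop 1 us)))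
     + (\<Sum>i = 1..n. sA ((- 1) ^ i)
         (f (take i xs @ drop (i + 1) xs)
            (take (i - 1) us @ r (us ! (i - 1)) (P (xs ! i) (us ! i)) # drop (i + 1) us)))
     + (\<Sum>i = 1..n. sA ((- 1) ^ i)
         (f (take (i - 1) xs @ drop i xs)
            (take (i - 1) us @ l (P (xs ! (i - 1)) (us ! (i - 1))) (us ! i) # drop (i + 1) us)))
     + sA ((- 1) ^ (n + 1)) (mu (f (take n xs) (take n us)) (P (xs ! n) (us ! n)))
     - sA ((- 1) ^ (n + 1)) (P (xs ! n) (l (f (take n xs) (take n us)) (us ! n)))
     else 0)"

definition h_map ::
  "nat \<Rightarrow> ('a list \<Rightarrow> 'a) \<Rightarrow> (('a + 'm) list \<Rightarrow> 'm) \<Rightarrow> 'x list \<Rightarrow> 'm list \<Rightarrow> 'a" where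
  "h_map n \<alpha> \<beta> xs us = (if length xs = n \<and> length us = n then
     (let as = map2 P xs us in
       sA ((- 1) ^ n)
         (\<alpha> as - (\<Sum>i = 1..n. P (xs ! (i - 1)) (\<beta> ((map Inl as)[i - 1 := Inr (us ! (i - 1))])))))
     else 0)"

text \<open>In degree 1 there is no third component; it is recorded as 0.\<close>

definition cochains :: "nat \<Rightarrow> ('a, 'm, 'x) cochain set" where
  "cochains n =
     (if n = 0 then {0}
      else multilinear_maps sA sA n \<times> mixed_maps n \<times> (if n = 1 then {0} else P_cochains (n - 1)))"

fun coboundary :: "nat \<Rightarrow> ('a, 'm, 'x) cochain \<Rightarrow> ('a, 'm, 'x) cochain" where
  "coboundary n (\<alpha>, \<beta>, \<gamma>) =
     (if n = 0 then 0
      else (hochschild n \<alpha>, hochschild_mixed n \<alpha> \<beta>,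
            if n = 1 then h_map n \<alpha> \<beta> else P_coboundary (n - 1) \<gamma> + h_map n \<alpha> \<beta>))"

definition cocycles :: "nat \<Rightarrow> ('a, 'm, 'x) cochain set" where
  "cocycles n = {c \<in> cochains n. coboundary n c = 0}"

definition coboundaries :: "nat \<Rightarrow> ('a, 'm, 'x) cochain set" where
  "coboundaries n = (if n = 0 then {0} else coboundary (n - 1) ` cochains (n - 1))"

definition cocycle_group :: "nat \<Rightarrow> ('a, 'm, 'x) cochain monoid" where
  "cocycle_group n = \<lparr>carrier = cocycles n, mult = (+), one = 0\<rparr>"

definition cohomology :: "nat \<Rightarrow> ('a, 'm, 'x) cochain set monoid" where
  "cohomology n = cocycle_group n Mod coboundaries n"

definition cohomology_class :: "nat \<Rightarrow> ('a, 'm, 'x) cochain \<Rightarrow> ('a, 'm, 'x) cochain set" where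
  "cohomology_class n c = coboundaries n #>\<^bsub>cocycle_group n\<^esub> c"

end

text \<open>The 2-cochain \<open>(mu1, \<beta>1, P1)\<close> where \<open>\<beta>1\<close> combines \<open>l1\<close> and \<open>r1\<close>.\<close>

fun cochain_of :: "('a::ab_group_add, 'm::ab_group_add, 'x) first_order \<Rightarrow> ('a, 'm, 'x) cochain" where
  "cochain_of (mu1, l1, r1, P1) =
     ((\<lambda>as. case as of [a, b] \<Rightarrow> mu1 a b | _ \<Rightarrow> 0),
      (\<lambda>w. case w of [Inl a, Inr u] \<Rightarrow> l1 a u | [Inr u, Inl a] \<Rightarrow> r1 u a | _ \<Rightarrow> 0),
      (\<lambda>xs us. case (xs, us) of ([x], [u]) \<Rightarrow> P1 x u | _ \<Rightarrow> 0))"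

end

theory Submission
  imports Defs
begin

text \<open>
  Every identity between maps over \<open>K[[t]]/(t^2)\<close> splits into its coefficients of \<open>1\<close> and \<open>t\<close>.
  For a deformed structure the coefficient of \<open>1\<close> is an axiom of the given algebra, and the
  coefficient of \<open>t\<close> is an equation that is additive in the first-order terms
  \<open>d = (mu1, l1, r1, P1)\<close>.  Associativity gives the Hochschild cocycle equation for \<open>mu1\<close>; the
  three bimodule axioms give the equation for \<open>\<beta>1\<close> on words with the letter from M in the third,
  second or first place; the matching identity gives the equation for \<open>P1\<close>, where the terms with
  \<open>mu1\<close> and \<open>\<beta>1\<close> make up the map \<open>h\<close> and those with \<open>P1\<close> its own coboundary.  Hence the
  deformations are exactly the 2-cocycles (\<open>cocycles_2\<close>).

  Similarly, that \<open>(id + t \<phi>, id + t \<psi>)\<close> is a morphism from the deformation \<open>d\<close> to \<open>d'\<close> says, in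
  the coefficient of \<open>t\<close>, that \<open>d - d'\<close> is the quadruple \<open>gauge \<phi> \<psi>\<close> determined by \<open>\<phi>\<close> and \<open>\<psi>\<close>
  (\<open>equivalent_deformations_iff\<close>), and this quadruple is the coboundary of the 1-cochain
  \<open>(\<phi>, \<psi>)\<close> (\<open>coboundary_one_cochain\<close>).  These quadruples form an additive group, so equivalence of
  deformations is congruence modulo this group, and the equivalence class of \<open>d\<close> corresponds to
  the coset of its cocycle modulo the 2-coboundaries.
\<close>

section \<open>Linear and bilinear maps\<close>

lemma module_homD:
  assumes "module_hom s1 s2 f"
  shows "f (x + y) = f x + f y" "f 0 = 0" "f (- x) = - f x" "f (x - y) = f x - f y" "f (s1 c x) = s2 c (f x)"
proof -
  interpret module_hom s1 s2 f by fact
  show "f (x + y) = f x + f y" "f 0 = 0" "f (- x) = - f x" "f (x - y) = f x - f y" "f (s1 c x) = s2 c (f x)"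
    by (rule add zero neg diff scale)+
qed

lemma module_hom_addI: "module_hom s1 s2 f \<Longrightarrow> module_hom s1 s2 g \<Longrightarrow> module_hom s1 s2 (f + g)"
  by (auto simp: module_hom_iff module_def algebra_simps)

lemma module_hom_uminusI: "module_hom s1 s2 f \<Longrightarrow> module_hom s1 s2 (- f)"
  by (auto simp: module_hom_iff module.scale_minus_right)

lemma module_hom_0I: "module s1 \<Longrightarrow> module s2 \<Longrightarrow> module_hom s1 s2 0"
  by (auto simp: module_hom_iff module.scale_zero_right)

lemma module_hom_idI: "module s \<Longrightarrow> module_hom s s id"
  by (simp add: module_hom_iff)

lemma bilinear_mapD:
  assumes "bilinear_map s1 s2 s3 f"
  shows "f (x + x') y = f x y + f x' y" "f x (y + y') = f x y + f x y'"
    "f 0 y = 0" "f x 0 = 0" "f (- x) y = - f x y" "f x (- y) = - f x y"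
    "f (s1 c x) y = s3 c (f x y)" "f x (s2 c y) = s3 c (f x y)"
proof -
  have R: "module_hom s2 s3 (\<lambda>y. f x y)" and L: "module_hom s1 s3 (\<lambda>x. f x y)" for x y
    using assms by (auto simp: bilinear_map_def)
  show "f (x + x') y = f x y + f x' y" "f 0 y = 0" "f (- x) y = - f x y" "f (s1 c x) y = s3 c (f x y)"
    using module_homD[OF L] by auto
  show "f x (y + y') = f x y + f x y'" "f x 0 = 0" "f x (- y) = - f x y" "f x (s2 c y) = s3 c (f x y)"
    using module_homD[OF R] by auto
qed

section \<open>Extension of scalars\<close>

lemma module_tps_scale:
  assumes "module s"
  shows "module (tps_scale s)"
proof -
  interpret module s by fact
  show ?thesis
    by unfold_locales
      (simp_all add: tps_scale_def plus_tps_def times_tps_def one_tps_def algebra_simps tps.expand)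
qed

lemma module_hom_tps_linear_ext:
  assumes "module_hom s1 s2 f" "module_hom s1 s2 f1"
  shows "module_hom (tps_scale s1) (tps_scale s2) (tps_linear_ext f f1)"
proof -
  have m: "module s1" "module s2" using assms(1) by (simp_all add: module_hom_iff)
  interpret s1: module s1 by fact
  interpret s2: module s2 by fact
  show ?thesis
    using assms
    by (auto simp: module_hom_iff module_tps_scale m tps_linear_ext_def plus_tps_def
        tps_scale_def algebra_simps)
qed

lemma bilinear_map_tps_bilinear_ext:
  assumes m: "module s1" "module s2" "module s3"
    and f: "bilinear_map s1 s2 s3 f" and f1: "bilinear_map s1 s2 s3 f1"
  shows "bilinear_map (tps_scale s1) (tps_scale s2) (tps_scale s3) (tps_bilinear_ext f f1)"
proof -
  interpret s1: module s1 by fact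
  interpret s2: module s2 by fact
  interpret s3: module s3 by fact
  show ?thesis
    unfolding bilinear_map_def module_hom_iff
    by (auto simp: module_tps_scale m tps_bilinear_ext_def plus_tps_def
        tps_scale_def bilinear_mapD[OF f] bilinear_mapD[OF f1] s3.scale_right_distrib
        s3.scale_left_distrib algebra_simps)
qed

text \<open>
  With four independent bilinear maps this one equivalence covers associativity of the
  algebra and all three bimodule axioms.
\<close>

lemma tps_associative_iff:
  assumes f: "bilinear_map s1 s2 s3 f" and g: "bilinear_map s4 s5 s6 g"
    and h: "bilinear_map s7 s8 s9 h" and k: "bilinear_map s10 s11 s12 k"
    and assoc: "\<And>a b c. f (g a b) c = h a (k b c)"
  shows "(\<forall>x y z. tps_bilinear_ext f f1 (tps_bilinear_ext g g1 x y) z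
              = tps_bilinear_ext h h1 x (tps_bilinear_ext k k1 y z))
     \<longleftrightarrow> (\<forall>a b c. f1 (g a b) c + f (g1 a b) c = h1 a (k b c) + h a (k1 b c))" (is "?L \<longleftrightarrow> ?R")
proof
  assume L: ?L
  show ?R
  proof (intro allI)
    fix a b c
    show "f1 (g a b) c + f (g1 a b) c = h1 a (k b c) + h a (k1 b c)"
      \<comment> \<open>On arguments without \<open>t\<close> only the first-order terms contribute to the coefficient of \<open>t\<close>.\<close>
      using L[rule_format, of "TPS a 0" "TPS b 0" "TPS c 0"]
      by (simp add: tps_bilinear_ext_def bilinear_mapD[OF f] bilinear_mapD[OF g]
          bilinear_mapD[OF h] bilinear_mapD[OF k] add.commute)
  qed
next
  assume R: ?R
  show ?L
    using R[rule_format]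
    by (simp add: tps_bilinear_ext_def bilinear_mapD[OF f] bilinear_mapD[OF g]
          bilinear_mapD[OF h] bilinear_mapD[OF k] assoc add.assoc add.left_commute)
     (simp add: add.commute)
qed

text \<open>
  The coefficient of \<open>1\<close> is trivial because both sides deform the same product \<open>f\<close>; the
  correction to \<open>f2\<close> is the Leibniz defect of the triple \<open>(p, q, c)\<close> for \<open>f\<close>.  It is used for the
  product (all three maps equal) and for both actions.
\<close>

lemma tps_multiplicative_iff:
  assumes f: "bilinear_map s1 s2 s3 f"
  shows "(\<forall>x y. tps_linear_ext id c (tps_bilinear_ext f f1 x y)
              = tps_bilinear_ext f f2 (tps_linear_ext id p x) (tps_linear_ext id q y))
     \<longleftrightarrow> (\<forall>a b. f1 a b = f2 a b + (f a (q b) - c (f a b) + f (p a) b))" (is "?L \<longleftrightarrow> ?R")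
proof
  assume L: ?L
  show ?R
  proof (intro allI)
    fix a b
    show "f1 a b = f2 a b + (f a (q b) - c (f a b) + f (p a) b)"
      using L[rule_format, of "TPS a 0" "TPS b 0"]
      by (simp add: tps_bilinear_ext_def tps_linear_ext_def bilinear_mapD[OF f] algebra_simps)
  qed
next
  assume R: ?R
  show ?L
    by (simp add: tps_bilinear_ext_def tps_linear_ext_def bilinear_mapD[OF f] R[rule_format]
        algebra_simps)
qed

lemma tps_intertwining_iff:
  assumes f: "module_hom s1 s2 f"
  shows "(\<forall>x. tps_linear_ext id q (tps_linear_ext f f1 x)
              = tps_linear_ext f f2 (tps_linear_ext id p x))
     \<longleftrightarrow> (\<forall>a. f1 a = f2 a + (f (p a) - q (f a)))" (is "?L \<longleftrightarrow> ?R")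
proof
  assume L: ?L
  show ?R
  proof (intro allI)
    fix a
    show "f1 a = f2 a + (f (p a) - q (f a))"
      using L[rule_format, of "TPS a 0"]
      by (simp add: tps_linear_ext_def module_homD[OF f] algebra_simps)
  qed
next
  assume R: ?R
  show ?L
    by (simp add: tps_linear_ext_def module_homD[OF f] R[rule_format] algebra_simps)
qed

section \<open>Deformations and their equivalences as equations between first-order terms\<close>

context mrrb_data
begin

definition first_order_terms :: "('a, 'm, 'x) first_order set" where
  "first_order_terms = {(mu1, l1, r1, P1).
     bilinear_map sA sA sA mu1 \<and> bilinear_map sA sM sM l1 \<and> bilinear_map sM sA sM r1 \<and>
     (\<forall>x. module_hom sM sA (P1 x))}"

text \<open>
  The coefficients of \<open>t\<close> in the five axioms of a matching relative Rota-Baxter algebra, for the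
  structure deformed by the given first-order terms.
\<close>

fun deformation_equations :: "('a, 'm, 'x) first_order \<Rightarrow> bool" where
  "deformation_equations (mu1, l1, r1, P1) \<longleftrightarrow>
     (\<forall>a b c. mu1 (mu a b) c + mu (mu1 a b) c = mu1 a (mu b c) + mu a (mu1 b c)) \<and>
     (\<forall>a b u. l1 (mu a b) u + l (mu1 a b) u = l1 a (l b u) + l a (l1 b u)) \<and>
     (\<forall>a u b. r1 (l a u) b + r (l1 a u) b = l1 a (r u b) + l a (r1 u b)) \<and>
     (\<forall>u a b. r1 (r u a) b + r (r1 u a) b = r1 u (mu a b) + r u (mu1 a b)) \<and>
     (\<forall>x u y v. mu (P x u) (P1 y v) + mu (P1 x u) (P y v) + mu1 (P x u) (P y v) =
         P x (r u (P1 y v)) + P x (r1 u (P y v)) + P1 x (r u (P y v)) +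
         P y (l (P1 x u) v) + P y (l1 (P x u) v) + P1 y (l (P x u) v))"

text \<open>
  The first-order change of the structure under the infinitesimal transformation
  \<open>(id + t \<phi>, id + t \<psi>)\<close>: the failure of \<open>\<phi>\<close> and \<open>\<psi>\<close> to be a derivation of the algebra, of
  its bimodule and of the operators.
\<close>

definition gauge :: "('a \<Rightarrow> 'a) \<Rightarrow> ('m \<Rightarrow> 'm) \<Rightarrow> ('a, 'm, 'x) first_order" where
  "gauge \<phi> \<psi> =
     ((\<lambda>a b. mu a (\<phi> b) - \<phi> (mu a b) + mu (\<phi> a) b),
      (\<lambda>a u. l a (\<psi> u) - \<psi> (l a u) + l (\<phi> a) u),
      (\<lambda>u a. r u (\<phi> a) - \<psi> (r u a) + r (\<psi> u) a),
      (\<lambda>x u. P x (\<psi> u) - \<phi> (P x u)))"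

definition gauge_terms :: "('a, 'm, 'x) first_order set" where
  "gauge_terms = {gauge \<phi> \<psi> | \<phi> \<psi>. module_hom sA sA \<phi> \<and> module_hom sM sM \<psi>}"

end

context mrrb_algebra
begin

lemmas mu_simps = bilinear_mapD[OF mu_bilinear]
lemmas l_simps = bilinear_mapD[OF l_bilinear]
lemmas r_simps = bilinear_mapD[OF r_bilinear]
lemmas P_simps = module_homD[OF P_linear]

lemma sA_minus_one [simp]: "sA (- 1) a = - a" "sA 1 a = a"
  using module.scale_minus_left[OF module_A, of 1 a] module.scale_one[OF module_A] by simp_all

lemma sM_minus_one [simp]: "sM (- 1) u = - u" "sM 1 u = u"
  using module.scale_minus_left[OF module_M, of 1 u] module.scale_one[OF module_M] by simp_all

lemma tps_matching_iff:
  "(\<forall>x u y v. tps_bilinear_ext mu mu1 (tps_linear_ext (P x) (P1 x) u) (tps_linear_ext (P y) (P1 y) v) =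
       tps_linear_ext (P x) (P1 x) (tps_bilinear_ext r r1 u (tps_linear_ext (P y) (P1 y) v)) +
       tps_linear_ext (P y) (P1 y) (tps_bilinear_ext l l1 (tps_linear_ext (P x) (P1 x) u) v))
   \<longleftrightarrow> (\<forall>x u y v. mu (P x u) (P1 y v) + mu (P1 x u) (P y v) + mu1 (P x u) (P y v) =
         P x (r u (P1 y v)) + P x (r1 u (P y v)) + P1 x (r u (P y v)) +
         P y (l (P1 x u) v) + P y (l1 (P x u) v) + P1 y (l (P x u) v))" (is "?L \<longleftrightarrow> ?R")
  if P1: "\<And>x. module_hom sM sA (P1 x)"
proof
  assume L: ?L
  show ?R
  proof (intro allI)
    fix x u y v
    show "mu (P x u) (P1 y v) + mu (P1 x u) (P y v) + mu1 (P x u) (P y v) =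
         P x (r u (P1 y v)) + P x (r1 u (P y v)) + P1 x (r u (P y v)) +
         P y (l (P1 x u) v) + P y (l1 (P x u) v) + P1 y (l (P x u) v)"
      using L[rule_format, of x "TPS u 0" y "TPS v 0"]
      by (simp add: tps_bilinear_ext_def tps_linear_ext_def plus_tps_def mu_simps l_simps r_simps
          P_simps module_homD[OF P1] algebra_simps)
  qed
next
  assume R: ?R
  show ?L
  proof (intro allI)
    fix x u y v
    show "tps_bilinear_ext mu mu1 (tps_linear_ext (P x) (P1 x) u) (tps_linear_ext (P y) (P1 y) v) =
       tps_linear_ext (P x) (P1 x) (tps_bilinear_ext r r1 u (tps_linear_ext (P y) (P1 y) v)) +
       tps_linear_ext (P y) (P1 y) (tps_bilinear_ext l l1 (tps_linear_ext (P x) (P1 x) u) v)"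
      using R[rule_format, of x "tcoeff0 u" y "tcoeff0 v"]
      by (simp add: tps_bilinear_ext_def tps_linear_ext_def plus_tps_def mu_simps l_simps r_simps
          P_simps module_homD[OF P1] P_matching algebra_simps)
  qed
qed

lemma mem_infinitesimal_deformations_iff:
  "d \<in> infinitesimal_deformations \<longleftrightarrow> d \<in> first_order_terms \<and> deformation_equations d"
proof (cases d)
  case (fields mu1 l1 r1 P1)
  have "mrrb_algebra (tps_scale sA) (tps_scale sM)
       (tps_bilinear_ext mu mu1) (tps_bilinear_ext l l1) (tps_bilinear_ext r r1)
       (\<lambda>x. tps_linear_ext (P x) (P1 x)) \<longleftrightarrow> deformation_equations (mu1, l1, r1, P1)"
    if "bilinear_map sA sA sA mu1" "bilinear_map sA sM sM l1" "bilinear_map sM sA sM r1"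
      and P1: "\<And>x. module_hom sM sA (P1 x)"
    unfolding mrrb_algebra_def deformation_equations.simps
    by (simp add: module_tps_scale bilinear_map_tps_bilinear_ext module_hom_tps_linear_ext
        module_A module_M mu_bilinear l_bilinear r_bilinear P_linear that
        tps_associative_iff[OF mu_bilinear mu_bilinear mu_bilinear mu_bilinear mu_assoc]
        tps_associative_iff[OF l_bilinear mu_bilinear l_bilinear l_bilinear l_assoc]
        tps_associative_iff[OF r_bilinear l_bilinear l_bilinear r_bilinear lr_assoc]
        tps_associative_iff[OF r_bilinear r_bilinear r_bilinear mu_bilinear r_assoc]
        tps_matching_iff[OF P1])
  then show ?thesis
    by (auto simp: fields infinitesimal_deformations_def first_order_terms_def
        simp del: deformation_equations.simps)
qed

lemma equivalent_deformations_iff: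
  assumes "d \<in> infinitesimal_deformations" "d' \<in> infinitesimal_deformations"
  shows "equivalent_deformations d d' \<longleftrightarrow> (\<exists>g \<in> gauge_terms. d = d' + g)"
proof (cases d, cases d')
  fix mu1 l1 r1 P1 mu2 l2 r2 P2
  assume d: "d = (mu1, l1, r1, P1)" "d' = (mu2, l2, r2, P2)"
  have "mrrb_morphism (tps_scale sA) (tps_scale sM)
          (tps_bilinear_ext mu mu1) (tps_bilinear_ext l l1) (tps_bilinear_ext r r1)
          (\<lambda>x. tps_linear_ext (P x) (P1 x))
          (tps_scale sA) (tps_scale sM)
          (tps_bilinear_ext mu mu2) (tps_bilinear_ext l l2) (tps_bilinear_ext r r2)
          (\<lambda>x. tps_linear_ext (P x) (P2 x))
          (tps_linear_ext id \<phi>) (tps_linear_ext id \<psi>) \<longleftrightarrow> d = d' + gauge \<phi> \<psi>"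
    if h: "module_hom sA sA \<phi>" "module_hom sM sM \<psi>" for \<phi> \<psi>
  proof -
    have "module_hom (tps_scale sA) (tps_scale sA) (tps_linear_ext id \<phi>)"
      "module_hom (tps_scale sM) (tps_scale sM) (tps_linear_ext id \<psi>)"
      using h module_hom_idI[OF module_A] module_hom_idI[OF module_M]
      by (blast intro: module_hom_tps_linear_ext)+
    then show ?thesis
      using assms h
      unfolding d mrrb_morphism_def mrrb_morphism_axioms_def infinitesimal_deformations_def
      by (simp add: gauge_def fun_eq_iff
        tps_multiplicative_iff[OF mu_bilinear]
        tps_multiplicative_iff[OF l_bilinear]
        tps_multiplicative_iff[OF r_bilinear]
        tps_intertwining_iff[OF P_linear])
  qed
  then show ?thesis
    unfolding d equivalent_deformations.simps gauge_terms_def by blast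
qed

lemma gauge_termsI:
  "module_hom sA sA \<phi> \<Longrightarrow> module_hom sM sM \<psi> \<Longrightarrow> gauge \<phi> \<psi> \<in> gauge_terms"
  unfolding gauge_terms_def by blast

lemma gauge_termsE:
  assumes "g \<in> gauge_terms"
  obtains \<phi> \<psi> where "g = gauge \<phi> \<psi>" "module_hom sA sA \<phi>" "module_hom sM sM \<psi>"
  using assms unfolding gauge_terms_def by blast

text \<open>
  \<open>gauge\<close> is additive in \<open>(\<phi>, \<psi>)\<close>, which is why equivalence of deformations, although defined
  by a morphism in one direction, is symmetric and transitive.
\<close>

lemma gauge_terms_subgroup:
  "0 \<in> gauge_terms"
  "g \<in> gauge_terms \<Longrightarrow> g' \<in> gauge_terms \<Longrightarrow> g + g' \<in> gauge_terms"
  "g \<in> gauge_terms \<Longrightarrow> - g \<in> gauge_terms"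
proof -
  have "gauge 0 0 = 0"
    by (simp add: gauge_def zero_prod_def fun_eq_iff mu_simps l_simps r_simps P_simps)
  moreover have "gauge 0 0 \<in> gauge_terms"
    by (intro gauge_termsI module_hom_0I module_A module_M)
  ultimately show "0 \<in> gauge_terms" by simp
  have "gauge \<phi> \<psi> + gauge \<phi>' \<psi>' = gauge (\<phi> + \<phi>') (\<psi> + \<psi>')" for \<phi> \<psi> \<phi>' \<psi>'
    by (simp add: gauge_def fun_eq_iff mu_simps l_simps r_simps P_simps algebra_simps)
  then show "g + g' \<in> gauge_terms" if "g \<in> gauge_terms" "g' \<in> gauge_terms"
    using that by (elim gauge_termsE) (simp add: gauge_termsI module_hom_addI)
  have "- gauge \<phi> \<psi> = gauge (- \<phi>) (- \<psi>)" for \<phi> \<psi>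
    by (simp add: gauge_def fun_eq_iff mu_simps l_simps r_simps P_simps algebra_simps)
  then show "- g \<in> gauge_terms" if "g \<in> gauge_terms"
    using that by (elim gauge_termsE) (simp add: gauge_termsI module_hom_uminusI)
qed

end

section \<open>Cochains of low degree\<close>

lemma cochain_of_add: "cochain_of (d + d') = cochain_of d + cochain_of d'"
  by (cases d, cases d') (auto simp: fun_eq_iff split: list.split sum.split)

text \<open>
  The four first-order terms are recovered from the cochain by evaluating it on words of length
  two and on singletons, so equations between cochains can be read as equations between
  first-order terms.
\<close>

lemma inj_cochain_of: "inj cochain_of"
proof (rule injI)
  fix d d' :: "('a::ab_group_add, 'm::ab_group_add, 'x) first_order"
  assume eq: "cochain_of d = cochain_of d'"
  obtain mu1 l1 r1 P1 mu2 l2 r2 P2 where d: "d = (mu1, l1, r1, P1)" "d' = (mu2, l2, r2, P2)"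
    by (cases d, cases d') auto
  have "mu1 a b = mu2 a b" for a b
    using eq unfolding d by (auto dest: fun_cong[of _ _ "[a, b]"])
  moreover have "l1 a u = l2 a u" for a u
    using eq unfolding d by (auto dest: fun_cong[of _ _ "[Inl a, Inr u]"])
  moreover have "r1 u a = r2 u a" for a u
    using eq unfolding d by (auto dest: fun_cong[of _ _ "[Inr u, Inl a]"])
  moreover have "P1 x u = P2 x u" for x u
    using eq unfolding d by (auto dest!: fun_cong[of _ _ "[x]"] fun_cong[of _ _ "[u]"])
  ultimately show "d = d'"
    unfolding d by (auto simp: fun_eq_iff)
qed

lemma eq_0_iff_on_support:
  "(\<And>x. \<not> Q x \<Longrightarrow> h x = 0) \<Longrightarrow> h = 0 \<longleftrightarrow> (\<forall>x. Q x \<longrightarrow> h x = 0)"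
  by (auto simp: fun_eq_iff)

lemma diff_eq_0_iff_eq_flip: "y - x = 0 \<longleftrightarrow> x = y" for x y :: "'b::ab_group_add"
  by auto

lemma mixed_word_1_iff: "mixed_word 1 w \<longleftrightarrow> (\<exists>u. w = [Inr u])"
proof
  assume w: "mixed_word 1 w"
  then obtain x where "w = [x]"
    by (auto simp: mixed_word_def length_Suc_conv)
  with w show "\<exists>u. w = [Inr u]"
    by (cases x) (auto simp: mixed_word_def)
qed (auto simp: mixed_word_def)

lemma mixed_word_2_iff:
  "mixed_word 2 w \<longleftrightarrow> (\<exists>a u. w = [Inl a, Inr u] \<or> w = [Inr u, Inl a])"
proof
  assume w: "mixed_word 2 w"
  then obtain x y where "w = [x, y]"
    by (auto simp: mixed_word_def numeral_2_eq_2 length_Suc_conv)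
  with w show "\<exists>a u. w = [Inl a, Inr u] \<or> w = [Inr u, Inl a]"
    by (cases x; cases y) (auto simp: mixed_word_def)
qed (auto simp: mixed_word_def)

lemma mixed_word_3_iff:
  "mixed_word 3 w \<longleftrightarrow>
     (\<exists>a b u. w = [Inl a, Inl b, Inr u] \<or> w = [Inl a, Inr u, Inl b] \<or> w = [Inr u, Inl a, Inl b])"
proof
  assume w: "mixed_word 3 w"
  then obtain x y z where "w = [x, y, z]"
    by (auto simp: mixed_word_def numeral_3_eq_3 length_Suc_conv)
  with w show "\<exists>a b u. w = [Inl a, Inl b, Inr u] \<or> w = [Inl a, Inr u, Inl b] \<or> w = [Inr u, Inl a, Inl b]"
    by (cases x; cases y; cases z) (auto simp: mixed_word_def)
qed (auto simp: mixed_word_def)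

lemma multilinear_maps_1_iff:
  "f \<in> multilinear_maps s1 s2 1 \<longleftrightarrow>
     (\<forall>as. length as \<noteq> 1 \<longrightarrow> f as = 0) \<and> module_hom s1 s2 (\<lambda>a. f [a])"
  by (auto simp: multilinear_maps_def)

lemma multilinear_maps_2_iff:
  "f \<in> multilinear_maps s s' 2 \<longleftrightarrow>
     (\<forall>as. length as \<noteq> 2 \<longrightarrow> f as = 0) \<and> bilinear_map s s s' (\<lambda>a b. f [a, b])"
proof -
  have "(\<forall>as bs. length as + length bs + 1 = 2 \<longrightarrow> module_hom s s' (\<lambda>a. f (as @ a # bs))) \<longleftrightarrow>
      (\<forall>b. module_hom s s' (\<lambda>a. f [b, a])) \<and> (\<forall>b. module_hom s s' (\<lambda>a. f [a, b]))" (is "?L \<longleftrightarrow> ?R")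
  proof
    assume L: ?L
    show ?R using L[rule_format, of "[_]" "[]"] L[rule_format, of "[]" "[_]"] by simp
  next
    assume R: ?R
    show ?L
    proof (intro allI impI)
      fix as bs :: "'a list"
      assume "length as + length bs + 1 = 2"
      then consider b where "as = []" "bs = [b]" | b where "as = [b]" "bs = []"
        by (cases as; cases bs) auto
      then show "module_hom s s' (\<lambda>a. f (as @ a # bs))"
        by cases (use R in simp_all)
    qed
  qed
  then show ?thesis
    by (simp add: multilinear_maps_def bilinear_map_def)
qed

context mrrb_algebra
begin

lemma mixed_maps_1_iff:
  "f \<in> mixed_maps 1 \<longleftrightarrow> (\<forall>w. \<not> mixed_word 1 w \<longrightarrow> f w = 0) \<and> module_hom sM sM (\<lambda>u. f [Inr u])"
  unfolding mixed_maps_def mixed_word_1_iff by (auto simp: append_eq_Cons_conv)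

lemma mixed_maps_2_iff:
  "f \<in> mixed_maps 2 \<longleftrightarrow> (\<forall>w. \<not> mixed_word 2 w \<longrightarrow> f w = 0) \<and>
     bilinear_map sA sM sM (\<lambda>a u. f [Inl a, Inr u]) \<and> bilinear_map sM sA sM (\<lambda>u a. f [Inr u, Inl a])"
proof -
  have A: "(\<forall>v w. mixed_word 2 (v @ Inl 0 # w) \<longrightarrow> module_hom sA sM (\<lambda>a. f (v @ Inl a # w))) \<longleftrightarrow>
    (\<forall>u. module_hom sA sM (\<lambda>a. f [Inl a, Inr u])) \<and> (\<forall>u. module_hom sA sM (\<lambda>a. f [Inr u, Inl a]))"
    (is "?L \<longleftrightarrow> ?R")
  proof
    assume L: ?L
    show ?R using L[rule_format, of "[]" "[Inr _]"] L[rule_format, of "[Inr _]" "[]"]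
      by (simp add: mixed_word_def)
  next
    assume ?R
    then show ?L unfolding mixed_word_2_iff by (auto simp: append_eq_Cons_conv)
  qed
  have M: "(\<forall>v w. mixed_word 2 (v @ Inr 0 # w) \<longrightarrow> module_hom sM sM (\<lambda>u. f (v @ Inr u # w))) \<longleftrightarrow>
    (\<forall>a. module_hom sM sM (\<lambda>u. f [Inr u, Inl a])) \<and> (\<forall>a. module_hom sM sM (\<lambda>u. f [Inl a, Inr u]))"
    (is "?L \<longleftrightarrow> ?R")
  proof
    assume L: ?L
    show ?R using L[rule_format, of "[]" "[Inl _]"] L[rule_format, of "[Inl _]" "[]"]
      by (simp add: mixed_word_def)
  next
    assume ?R
    then show ?L unfolding mixed_word_2_iff by (auto simp: append_eq_Cons_conv)
  qed
  show ?thesis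
    unfolding mixed_maps_def mem_Collect_eq A M bilinear_map_def by blast
qed

lemma P_cochains_1_iff:
  "f \<in> P_cochains 1 \<longleftrightarrow> (\<forall>xs us. length xs \<noteq> 1 \<or> length us \<noteq> 1 \<longrightarrow> f xs us = 0) \<and>
     (\<forall>x. module_hom sM sA (\<lambda>u. f [x] [u]))"
  unfolding P_cochains_def multilinear_maps_1_iff
  by (auto simp: length_Suc_conv fun_eq_iff split: if_splits)

text \<open>
  A 2-cochain vanishes off its meaningful arguments and is linear in each of them; on these
  arguments it consists of a bilinear product, two bilinear actions (one for each position of
  the letter from M) and a family of linear operators.
\<close>

lemma cochains_2: "cochains 2 = cochain_of ` first_order_terms"
proof
  show "cochain_of ` first_order_terms \<subseteq> cochains 2"
    by (auto simp: cochains_def first_order_terms_def multilinear_maps_2_iff mixed_maps_2_iff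
        P_cochains_1_iff[unfolded One_nat_def] mixed_word_2_iff split: list.splits sum.splits)
next
  show "cochains 2 \<subseteq> cochain_of ` first_order_terms"
  proof
    fix c assume c: "c \<in> cochains 2"
    obtain \<alpha> \<beta> \<gamma> where abc: "c = (\<alpha>, \<beta>, \<gamma>)" by (cases c)
    have abg: "\<alpha> \<in> multilinear_maps sA sA 2" "\<beta> \<in> mixed_maps 2" "\<gamma> \<in> P_cochains 1"
      using c by (simp_all add: abc cochains_def)
    define d where "d = ((\<lambda>a b. \<alpha> [a, b]), (\<lambda>a u. \<beta> [Inl a, Inr u]), (\<lambda>u a. \<beta> [Inr u, Inl a]),
        (\<lambda>x u. \<gamma> [x] [u]))"
    have "d \<in> first_order_terms"
      using abg by (auto simp: first_order_terms_def d_def multilinear_maps_2_iff mixed_maps_2_iff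
          P_cochains_1_iff[unfolded One_nat_def])
    moreover have "c = cochain_of d"
      using abg by (auto simp: abc d_def multilinear_maps_2_iff mixed_maps_2_iff mixed_word_2_iff
          P_cochains_1_iff[unfolded One_nat_def] fun_eq_iff split: list.splits sum.splits)
    ultimately show "c \<in> cochain_of ` first_order_terms" by blast
  qed
qed

text \<open>
  The value \<open>0\<close> on all other lists is the convention that makes equality of cochains equality of
  functions; the third component is \<open>0\<close> because there is none in degree one.
\<close>

definition one_cochain :: "('a \<Rightarrow> 'a) \<Rightarrow> ('m \<Rightarrow> 'm) \<Rightarrow> ('a, 'm, 'x) cochain" where
  "one_cochain \<phi> \<psi> =
     ((\<lambda>as. case as of [a] \<Rightarrow> \<phi> a | _ \<Rightarrow> 0), (\<lambda>w. case w of [Inr u] \<Rightarrow> \<psi> u | _ \<Rightarrow> 0), 0)"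

lemma cochains_1:
  "cochains 1 = {one_cochain \<phi> \<psi> | \<phi> \<psi>. module_hom sA sA \<phi> \<and> module_hom sM sM \<psi>}"
proof
  show "{one_cochain \<phi> \<psi> | \<phi> \<psi>. module_hom sA sA \<phi> \<and> module_hom sM sM \<psi>} \<subseteq> cochains 1"
    unfolding cochains_def one_cochain_def multilinear_maps_1_iff mixed_maps_1_iff mixed_word_1_iff
    by (auto simp: mixed_maps_1_iff[unfolded One_nat_def] mixed_word_1_iff[unfolded One_nat_def]
        multilinear_maps_1_iff[unfolded One_nat_def] split: list.splits sum.splits)
next
  show "cochains 1 \<subseteq> {one_cochain \<phi> \<psi> | \<phi> \<psi>. module_hom sA sA \<phi> \<and> module_hom sM sM \<psi>}"
  proof
    fix c assume c: "c \<in> cochains 1"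
    obtain \<alpha> \<beta> \<gamma> where abc: "c = (\<alpha>, \<beta>, \<gamma>)" by (cases c)
    have abg: "\<alpha> \<in> multilinear_maps sA sA 1" "\<beta> \<in> mixed_maps 1" "\<gamma> = 0"
      using c by (simp_all add: abc cochains_def)
    have "c = one_cochain (\<lambda>a. \<alpha> [a]) (\<lambda>u. \<beta> [Inr u])"
      using abg unfolding multilinear_maps_1_iff mixed_maps_1_iff mixed_word_1_iff
      by (auto simp: abc one_cochain_def fun_eq_iff split: list.splits sum.splits)
    moreover have "module_hom sA sA (\<lambda>a. \<alpha> [a])" "module_hom sM sM (\<lambda>u. \<beta> [Inr u])"
      using abg unfolding multilinear_maps_1_iff mixed_maps_1_iff by auto
    ultimately show "c \<in> {one_cochain \<phi> \<psi> | \<phi> \<psi>. module_hom sA sA \<phi> \<and> module_hom sM sM \<psi>}"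
      by blast
  qed
qed

section \<open>The coboundary in degrees one and two\<close>

text \<open>
  Since \<open>h\<close> carries the sign \<open>(-1)^n = -1\<close> in degree one, its value
  \<open>P x (\<psi> u) - \<phi> (P x u)\<close> has the same orientation as the Hochschild components, in which \<open>\<phi>\<close> and
  \<open>\<psi>\<close> of a product appear with a minus sign.
\<close>

lemma coboundary_one_cochain:
  "coboundary 1 (one_cochain \<phi> \<psi>) = cochain_of (gauge \<phi> \<psi>)"
proof -
  let ?\<alpha> = "\<lambda>as. case as of [a] \<Rightarrow> \<phi> a | _ \<Rightarrow> 0"
  let ?\<beta> = "\<lambda>w::('a + 'm) list. case w of [Inr u] \<Rightarrow> \<psi> u | _ \<Rightarrow> 0"
  obtain mu1 l1 r1 P1 where g: "gauge \<phi> \<psi> = (mu1, l1, r1, P1)" by (cases "gauge \<phi> \<psi>")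
  have "hochschild 1 ?\<alpha> as = (case as of [a, b] \<Rightarrow> mu1 a b | _ \<Rightarrow> 0)" for as
    using g by (auto simp: gauge_def hochschild_def split: list.split)
  moreover have "hochschild_mixed 1 ?\<alpha> ?\<beta> w =
     (case w of [Inl a, Inr u] \<Rightarrow> l1 a u | [Inr u, Inl a] \<Rightarrow> r1 u a | _ \<Rightarrow> 0)" for w
  proof (cases "mixed_word 2 w")
    case True
    then show ?thesis
      using g unfolding mixed_word_2_iff
      by (auto simp: gauge_def hochschild_mixed_def mixed_word_def)
  next
    case False
    then show ?thesis
      by (auto simp: hochschild_mixed_def mixed_word_2_iff numeral_2_eq_2[symmetric]
          split: list.split sum.split)
  qed
  moreover have "h_map 1 ?\<alpha> ?\<beta> xs us = (case (xs, us) of ([x], [u]) \<Rightarrow> P1 x u | _ \<Rightarrow> 0)" for xs us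
    using g by (auto simp: gauge_def h_map_def Let_def split: list.split)
  ultimately show ?thesis
    by (simp add: one_cochain_def g fun_eq_iff)
qed

lemma coboundaries_2: "coboundaries 2 = cochain_of ` gauge_terms"
proof -
  have "coboundaries 2 = coboundary 1 ` cochains 1"
    by (simp add: coboundaries_def)
  also have "\<dots> = {coboundary 1 (one_cochain \<phi> \<psi>) | \<phi> \<psi>. module_hom sA sA \<phi> \<and> module_hom sM sM \<psi>}"
    unfolding cochains_1 by blast
  also have "\<dots> = cochain_of ` gauge_terms"
    unfolding coboundary_one_cochain gauge_terms_def by blast
  finally show ?thesis .
qed

lemma hochschild_eq_0_iff:
  "hochschild 2 (\<lambda>as. case as of [a, b] \<Rightarrow> mu1 a b | _ \<Rightarrow> 0) = 0 \<longleftrightarrow>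
     (\<forall>a b c. mu1 (mu a b) c + mu (mu1 a b) c = mu1 a (mu b c) + mu a (mu1 b c))" (is "?h = 0 \<longleftrightarrow> ?R")
proof -
  have "?h = 0 \<longleftrightarrow> (\<forall>as. length as = 3 \<longrightarrow> ?h as = 0)"
    by (rule eq_0_iff_on_support) (simp add: hochschild_def)
  also have "\<dots> \<longleftrightarrow> (\<forall>a b c. ?h [a, b, c] = 0)"
    unfolding numeral_3_eq_3 length_Suc_conv length_0_conv by blast
  also have "\<dots> \<longleftrightarrow> ?R"
  proof -
    have "?h [a, b, c] =
        (mu1 a (mu b c) + mu a (mu1 b c)) - (mu1 (mu a b) c + mu (mu1 a b) c)" for a b c
      by (simp add: hochschild_def numeral_2_eq_2)
    then show ?thesis
      by (simp only: diff_eq_0_iff_eq_flip)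
  qed
  finally show ?thesis .
qed

text \<open>
  One equation for each position of the letter from M in a word of length three: third place for
  the left action, second for the compatibility of the two actions, first for the right action.
\<close>

lemma hochschild_mixed_eq_0_iff:
  "hochschild_mixed 2 (\<lambda>as. case as of [a, b] \<Rightarrow> mu1 a b | _ \<Rightarrow> 0)
       (\<lambda>w. case w of [Inl a, Inr u] \<Rightarrow> l1 a u | [Inr u, Inl a] \<Rightarrow> r1 u a | _ \<Rightarrow> 0) = 0 \<longleftrightarrow>
     (\<forall>a b u. l1 (mu a b) u + l (mu1 a b) u = l1 a (l b u) + l a (l1 b u)) \<and>
     (\<forall>a u b. r1 (l a u) b + r (l1 a u) b = l1 a (r u b) + l a (r1 u b)) \<and>
     (\<forall>u a b. r1 (r u a) b + r (r1 u a) b = r1 u (mu a b) + r u (mu1 a b))" (is "?h = 0 \<longleftrightarrow> ?R")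
proof -
  have "?h = 0 \<longleftrightarrow> (\<forall>w. mixed_word 3 w \<longrightarrow> ?h w = 0)"
    by (rule eq_0_iff_on_support) (simp add: hochschild_mixed_def)
  also have "\<dots> \<longleftrightarrow> (\<forall>a b u. ?h [Inl a, Inl b, Inr u] = 0) \<and> (\<forall>a u b. ?h [Inl a, Inr u, Inl b] = 0)
     \<and> (\<forall>u a b. ?h [Inr u, Inl a, Inl b] = 0)"
    unfolding mixed_word_3_iff by blast
  also have "\<dots> \<longleftrightarrow> ?R"
  proof -
    have "?h [Inl a, Inl b, Inr u] =
        (l1 a (l b u) + l a (l1 b u)) - (l1 (mu a b) u + l (mu1 a b) u)"
      "?h [Inl a, Inr u, Inl b] =
        (l1 a (r u b) + l a (r1 u b)) - (r1 (l a u) b + r (l1 a u) b)"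
      "?h [Inr u, Inl a, Inl b] =
        (r1 u (mu a b) + r u (mu1 a b)) - (r1 (r u a) b + r (r1 u a) b)" for a b u
      by (simp_all add: hochschild_mixed_def mixed_word_def numeral_2_eq_2)
    then show ?thesis
      by (simp only: diff_eq_0_iff_eq_flip)
  qed
  finally show ?thesis .
qed

text \<open>
  In degree two \<open>h\<close> has the sign \<open>+1\<close> and contributes \<open>mu1\<close>, \<open>l1\<close> and \<open>r1\<close>, while the coboundary of
  \<open>P1\<close> contributes all terms in which one of the two operators of the matching identity is
  replaced by its first-order term.
\<close>

lemma P_component_eq_0_iff:
  "P_coboundary 1 (\<lambda>xs us. case (xs, us) of ([x], [u]) \<Rightarrow> P1 x u | _ \<Rightarrow> 0) +
     h_map 2 (\<lambda>as. case as of [a, b] \<Rightarrow> mu1 a b | _ \<Rightarrow> 0)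
       (\<lambda>w. case w of [Inl a, Inr u] \<Rightarrow> l1 a u | [Inr u, Inl a] \<Rightarrow> r1 u a | _ \<Rightarrow> 0) = 0 \<longleftrightarrow>
     (\<forall>x u y v. mu (P x u) (P1 y v) + mu (P1 x u) (P y v) + mu1 (P x u) (P y v) =
         P x (r u (P1 y v)) + P x (r1 u (P y v)) + P1 x (r u (P y v)) +
         P y (l (P1 x u) v) + P y (l1 (P x u) v) + P1 y (l (P x u) v))" (is "?h = 0 \<longleftrightarrow> ?R")
proof -
  have "?h xs = 0" if "length xs \<noteq> 2" for xs
    using that by (auto simp: fun_eq_iff P_coboundary_def h_map_def)
  then have "?h = 0 \<longleftrightarrow> (\<forall>xs. length xs = 2 \<longrightarrow> ?h xs = 0)"
    by (rule eq_0_iff_on_support)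
  also have "\<dots> \<longleftrightarrow> (\<forall>xs. length xs = 2 \<longrightarrow> (\<forall>us. length us = 2 \<longrightarrow> ?h xs us = 0))"
  proof -
    have "?h xs = 0 \<longleftrightarrow> (\<forall>us. length us = 2 \<longrightarrow> ?h xs us = 0)" for xs
      by (rule eq_0_iff_on_support) (simp add: P_coboundary_def h_map_def)
    then show ?thesis by blast
  qed
  also have "\<dots> \<longleftrightarrow> (\<forall>x u y v. ?h [x, y] [u, v] = 0)"
    unfolding numeral_2_eq_2 length_Suc_conv length_0_conv by blast
  also have "\<dots> \<longleftrightarrow> ?R"
  proof -
    have "?h [x, y] [u, v] =
      (mu (P x u) (P1 y v) + mu (P1 x u) (P y v) + mu1 (P x u) (P y v)) -
        (P x (r u (P1 y v)) + P x (r1 u (P y v)) + P1 x (r u (P y v)) +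
         P y (l (P1 x u) v) + P y (l1 (P x u) v) + P1 y (l (P x u) v))" for x y u v
      by (simp add: P_coboundary_def h_map_def numeral_2_eq_2 algebra_simps)
    then show ?thesis
      by (simp only: right_minus_eq)
  qed
  finally show ?thesis .
qed

lemma coboundary_cochain_of_eq_0_iff:
  "coboundary 2 (cochain_of d) = 0 \<longleftrightarrow> deformation_equations d"
proof (cases d)
  case (fields mu1 l1 r1 P1)
  let ?\<alpha> = "\<lambda>as. case as of [a, b] \<Rightarrow> mu1 a b | _ \<Rightarrow> 0"
  let ?\<beta> = "\<lambda>w. case w of [Inl a, Inr u] \<Rightarrow> l1 a u | [Inr u, Inl a] \<Rightarrow> r1 u a | _ \<Rightarrow> 0"
  have "coboundary 2 (cochain_of d) = (hochschild 2 ?\<alpha>, hochschild_mixed 2 ?\<alpha> ?\<beta>,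
      P_coboundary 1 (\<lambda>xs us. case (xs, us) of ([x], [u]) \<Rightarrow> P1 x u | _ \<Rightarrow> 0) + h_map 2 ?\<alpha> ?\<beta>)"
    by (simp add: fields)
  then show ?thesis
    unfolding fields deformation_equations.simps zero_prod_def
    by (simp only: prod.inject hochschild_eq_0_iff hochschild_mixed_eq_0_iff P_component_eq_0_iff
        conj_assoc)
qed

lemma cocycles_2: "cocycles 2 = cochain_of ` infinitesimal_deformations"
proof -
  have "infinitesimal_deformations = {d \<in> first_order_terms. coboundary 2 (cochain_of d) = 0}"
    unfolding coboundary_cochain_of_eq_0_iff set_eq_iff mem_Collect_eq
    using mem_infinitesimal_deformations_iff by blast
  then show ?thesis
    unfolding cocycles_def cochains_2 by blast
qed

section \<open>Equivalence classes and cohomology classes\<close>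

lemma deformation_equivalence_iff:
  "(d, d') \<in> deformation_equivalence \<longleftrightarrow>
     d \<in> infinitesimal_deformations \<and> d' \<in> infinitesimal_deformations \<and> d - d' \<in> gauge_terms"
proof -
  have "(\<exists>g\<in>gauge_terms. d = d' + g) \<longleftrightarrow> d - d' \<in> gauge_terms"
    by (metis add_diff_cancel_left' add_diff_cancel_right' diff_add_cancel add.commute)
  then show ?thesis
    by (auto simp: deformation_equivalence_def equivalent_deformations_iff)
qed

text \<open>
  By additivity of \<open>cochain_of\<close>, a coset of 2-coboundaries is the image of a coset of gauge terms.
  The comparison of cohomology classes can thus be made among first-order terms.
\<close>

lemma cohomology_class_cochain_of:
  "cohomology_class 2 (cochain_of d) = cochain_of ` {g + d | g. g \<in> gauge_terms}"
proof -
  have "cohomology_class 2 (cochain_of d) = {cochain_of g + cochain_of d | g. g \<in> gauge_terms}"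
    unfolding cohomology_class_def r_coset_def coboundaries_2 cocycle_group_def monoid.simps by blast
  then show ?thesis
    unfolding cochain_of_add[symmetric] by blast
qed

text \<open>
  The coset of \<open>d\<close> contains \<open>d\<close> itself, because \<open>0\<close> is a gauge term, so equal cosets differ by a
  gauge term; conversely, closure under sums and negatives makes the cosets agree.
\<close>

lemma cohomology_class_cochain_of_eq_iff:
  "cohomology_class 2 (cochain_of d) = cohomology_class 2 (cochain_of d') \<longleftrightarrow> d - d' \<in> gauge_terms"
proof -
  have "{g + d | g. g \<in> gauge_terms} = {g + d' | g. g \<in> gauge_terms} \<longleftrightarrow> d - d' \<in> gauge_terms"
    (is "?S d = ?S d' \<longleftrightarrow> _")
  proof
    assume "?S d = ?S d'"
    moreover have "d \<in> ?S d"
      using gauge_terms_subgroup(1) by force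
    ultimately obtain g where "d = g + d'" "g \<in> gauge_terms" by blast
    then show "d - d' \<in> gauge_terms" by simp
  next
    have sub: "?S d \<subseteq> ?S d'" if "d - d' \<in> gauge_terms" for d d'
    proof
      fix e assume "e \<in> ?S d"
      then obtain g where g: "e = g + d" "g \<in> gauge_terms" by blast
      from g(2) have "g + (d - d') \<in> gauge_terms"
        using that by (rule gauge_terms_subgroup)
      moreover have "g + d = g + (d - d') + d'" by simp
      ultimately show "e \<in> ?S d'" unfolding g(1) by blast
    qed
    assume "d - d' \<in> gauge_terms"
    moreover from gauge_terms_subgroup(3)[OF this] have "d' - d \<in> gauge_terms" by simp
    ultimately show "?S d = ?S d'" using sub by blast
  qed
  then show ?thesis
    unfolding cohomology_class_cochain_of inj_image_eq_iff[OF inj_cochain_of] .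
qed

lemma carrier_cohomology_2:
  "carrier (cohomology 2) = (\<lambda>d. cohomology_class 2 (cochain_of d)) ` infinitesimal_deformations"
proof -
  have "carrier (cohomology 2) = cohomology_class 2 ` carrier (cocycle_group 2)"
    by (auto simp: cohomology_def FactGroup_def RCOSETS_def cohomology_class_def)
  then show ?thesis
    by (simp add: cocycle_group_def cocycles_2 image_image)
qed

lemma equiv_deformation_equivalence:
  "equiv infinitesimal_deformations deformation_equivalence"
proof (rule equivI)
  show "deformation_equivalence \<subseteq> infinitesimal_deformations \<times> infinitesimal_deformations"
    by (auto simp: deformation_equivalence_def)
  show "refl_on infinitesimal_deformations deformation_equivalence"
    by (simp add: refl_on_def deformation_equivalence_iff gauge_terms_subgroup)
  show "sym deformation_equivalence"
    using gauge_terms_subgroup(3) by (fastforce simp: sym_def deformation_equivalence_iff)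
  show "trans deformation_equivalence"
    using gauge_terms_subgroup(2) by (fastforce simp: trans_def deformation_equivalence_iff)
qed

end

lemma bij_betw_quotient_image:
  assumes E: "equiv D E"
    and f: "\<And>d d'. d \<in> D \<Longrightarrow> d' \<in> D \<Longrightarrow> (d, d') \<in> E \<longleftrightarrow> f d = f d'"
  shows "\<exists>\<Phi>. bij_betw \<Phi> (D // E) (f ` D) \<and> (\<forall>d\<in>D. \<Phi> (E `` {d}) = f d)"
proof -
  define \<Phi> where "\<Phi> K = the_elem (f ` K)" for K
  have \<Phi>: "\<Phi> (E `` {d}) = f d" if "d \<in> D" for d
  proof -
    have "d \<in> E `` {d}" "E `` {d} \<subseteq> D"
      using E that by (auto simp: equiv_def refl_on_def)
    then have "f ` (E `` {d}) = {f d}"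
      using f that by auto
    then show ?thesis by (simp add: \<Phi>_def)
  qed
  have "inj_on \<Phi> (D // E)"
  proof (rule inj_onI, elim quotientE)
    fix K K' d d' assume *: "\<Phi> K = \<Phi> K'" "d \<in> D" "d' \<in> D" "K = E `` {d}" "K' = E `` {d'}"
    then have "(d, d') \<in> E" by (simp add: \<Phi> f)
    with E * show "K = K'" by (simp add: equiv_class_eq)
  qed
  moreover have "\<Phi> ` (D // E) = f ` D"
  proof -
    have "\<Phi> ` (D // E) = (\<lambda>d. \<Phi> (E `` {d})) ` D"
      by (auto simp: quotient_def)
    also have "\<dots> = f ` D"
      using \<Phi> by (rule image_cong[OF refl])
    finally show ?thesis .
  qed
  ultimately show ?thesis
    using \<Phi> by (auto simp: bij_betw_def)
qed

theorem theorem5p5: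
  fixes sA :: "'k::comm_ring_1 \<Rightarrow> 'a::ab_group_add \<Rightarrow> 'a"
    and sM :: "'k \<Rightarrow> 'm::ab_group_add \<Rightarrow> 'm"
    and mu :: "'a \<Rightarrow> 'a \<Rightarrow> 'a"
    and l :: "'a \<Rightarrow> 'm \<Rightarrow> 'm"
    and r :: "'m \<Rightarrow> 'a \<Rightarrow> 'm"
    and P :: "'x \<Rightarrow> 'm \<Rightarrow> 'a"
  assumes "CHAR('k) \<noteq> 2"
    and "mrrb_algebra sA sM mu l r P"
  shows "let D = mrrb_data.infinitesimal_deformations sA sM mu l r P;
             E = mrrb_data.deformation_equivalence sA sM mu l r P
         in equiv D E \<and>
            (\<forall>d\<in>D. cochain_of d \<in> mrrb_data.cocycles sA sM mu l r P 2) \<and>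
            (\<exists>\<Phi>. bij_betw \<Phi> (D // E) (carrier (mrrb_data.cohomology sA sM mu l r P 2)) \<and>
                 (\<forall>d\<in>D. \<Phi> (E `` {d}) =
                    mrrb_data.cohomology_class sA sM mu l r P 2 (cochain_of d)))"
proof -
  interpret mrrb_algebra sA sM mu l r P by fact
  have "\<exists>\<Phi>. bij_betw \<Phi> (infinitesimal_deformations // deformation_equivalence) (carrier (cohomology 2)) \<and>
      (\<forall>d\<in>infinitesimal_deformations.
         \<Phi> (deformation_equivalence `` {d}) = cohomology_class 2 (cochain_of d))"
    unfolding carrier_cohomology_2
    by (rule bij_betw_quotient_image[OF equiv_deformation_equivalence])
      (simp add: deformation_equivalence_iff cohomology_class_cochain_of_eq_iff)
  then show ?thesis
    unfolding Let_def cocycles_2 using equiv_deformation_equivalence by blast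
qed

end
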